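(* Let $X$ be a complete $RN$ module over $K$ with base $(\Omega,\mathcal F,P)$, let $C\in B(X)$ be injective, and let $\{V(s):s\ge0\}$ be a locally a.s. bounded $C$-semigroup on $X$ with generator $(A,D(A))$. For any $z\in C(D(A))$, define a mapping $g:[0,+\infty)\to X$ by $g(s)=CV(s)z$. Then $g$ is locally $L^0$-Lipschitz.
   Context: $(\Omega,\mathcal F,P)$ is a probability space, $K=\mathbb R$ or $\mathbb C$, $L^0(\mathcal F,K)$ is the algebra of equivalence classes (a.s. equality) of $K$-valued $\mathcal F$-measurable random variables, $\bar L^0(\mathcal F,R)$ the complete lattice of equivalence classes of extended real-valued random variables under a.s. order, and $L^0_+(\mathcal F)=\{\xi\in L^0(\mathcal F,R):\xi\ge 0\}$. $\bigvee$ and $\bigwedge$ denote supremum and infimum in $\bar L^0(\mathcal F,R)$. An $RN$ module over $K$ with base $(\Omega,\mathcal F,P)$ is an $L^0(\mathcal F,K)$-module $X$ with a map $\|\cdot\|:X\to L^0_+(\mathcal F)$ (the $L^0$-norm) such that $\|\xi x\|=|\xi|\|x\|$ for all $\xi\in L^0(\mathcal F,K)$, $x\in X$; $\|x+y\|\le\|x\|+\|y\|$; and $\|x\|=0$ implies $x=0$. It carries the $(\varepsilon,\lambda)$-topology, the metrizable linear topology with local base at $0$ given by $\{z: P(\|z\|<\varepsilon)>\lambda\}$, $\varepsilon>0$, $0<\lambda<1$; so $z_n\to z$ iff $\|z_n-z\|\to0$ in probability. Completeness, limits and continuity are in this topology. A linear operator $T:X\to X$ is a.s. bounded if there is $\eta\in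 L^0_+(\mathcal F)$ with $\|Tz\|\le\eta\|z\|$ for all $z\in X$; $B(X)$ is the set of these (equivalently, the continuous $L^0(\mathcal F,K)$-module homomorphisms on $X$), and $\|T\|=\bigwedge\{\eta\in L^0_+(\mathcal F):\|Tz\|\le\eta\|z\|\ \forall z\in X\}$. $R(C)$ is the range of $C$. $C$-semigroup on $X$ ($C\in B(X)$ injective): a family $\{V(s):s\ge0\}\subset B(X)$ such that $s\mapsto V(s)z$ is continuous from $[0,\infty)$ to $X$ for every $z\in X$; $V(0)=C$; and $CV(s+t)=V(s)V(t)$ for all $s,t\ge0$. It is locally a.s. bounded if $\bigvee_{s\in[0,l]}\|V(s)\|\in L^0_+(\mathcal F)$ for every $l>0$. Its generator $(A,D(A))$ is given by $D(A)=\{z\in X:\lim_{s\downarrow0}\frac{V(s)z-Cz}{s}\text{ exists and belongs to }R(C)\}$ and $Az=C^{-1}\lim_{s\downarrow0}\frac{V(s)z-Cz}{s}$ for $z\in D(A)$. A function $g:[0,\infty)\to X$ is locally $L^0$-Lipschitz if for every $l>0$ there is $\xi_l\in L^0_+(\mathcal F)$ with $\|g(s_1)-g(s_2)\|\le\xi_l|s_1-s_2|$ for all $s_1,s_2\in[0,l]$. *)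

theory Defs
  imports "HOL-Probability.Probability" "HOL-Algebra.Module" "HOL-Algebra.Complete_Lattice"
begin

section \<open>Equivalence classes of random variables\<close>

definition ae_eq :: "'w measure \<Rightarrow> ('w \<Rightarrow> 'b::topological_space) rel" where
  "ae_eq M = {(f, g). f \<in> borel_measurable M \<and> g \<in> borel_measurable M \<and> (AE w in M. f w = g w)}"

definition L0 :: "'w measure \<Rightarrow> ('w \<Rightarrow> 'b::topological_space) set set" where
  "L0 M = borel_measurable M // ae_eq M"

definition L0_class :: "'w measure \<Rightarrow> ('w \<Rightarrow> 'b::topological_space) \<Rightarrow> ('w \<Rightarrow> 'b) set" where
  "L0_class M f = ae_eq M `` {f}"

text \<open>An arbitrary representative; everything below that is built from it depends only on the class.\<close>

definition L0_rep :: "('w \<Rightarrow> 'b) set \<Rightarrow> 'w \<Rightarrow> 'b" where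
  "L0_rep \<xi> = (SOME f. f \<in> \<xi>)"

definition L0_const :: "'w measure \<Rightarrow> 'b::topological_space \<Rightarrow> ('w \<Rightarrow> 'b) set" where
  "L0_const M c = L0_class M (\<lambda>_. c)"

definition L0_le :: "'w measure \<Rightarrow> ('w \<Rightarrow> 'b::{topological_space, ord}) set \<Rightarrow> ('w \<Rightarrow> 'b) set \<Rightarrow> bool" where
  "L0_le M \<xi> \<eta> \<longleftrightarrow> (AE w in M. L0_rep \<xi> w \<le> L0_rep \<eta> w)"

text \<open>
  The scalar field \<open>K\<close> is a type of class \<^class>\<open>real_normed_field\<close>. Both \<^typ>\<open>real\<close> and
  \<^typ>\<open>complex\<close> are instances, and by Gelfand-Mazur every instance is isometrically isomorphic to
  one of them, so that \<^class>\<open>second_countable_topology\<close> is no further restriction.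
\<close>

definition L0_ring ::
  "'w measure \<Rightarrow> ('w \<Rightarrow> 'k::{real_normed_field, second_countable_topology}) set ring" where
  "L0_ring M = \<lparr>carrier = L0 M,
     mult = (\<lambda>\<xi> \<eta>. L0_class M (\<lambda>w. L0_rep \<xi> w * L0_rep \<eta> w)),
     one = L0_const M 1,
     zero = L0_const M 0,
     add = (\<lambda>\<xi> \<eta>. L0_class M (\<lambda>w. L0_rep \<xi> w + L0_rep \<eta> w))\<rparr>"

definition L0_abs ::
  "'w measure \<Rightarrow> ('w \<Rightarrow> 'k::{real_normed_field, second_countable_topology}) set \<Rightarrow> ('w \<Rightarrow> real) set" where
  "L0_abs M \<xi> = L0_class M (\<lambda>w. norm (L0_rep \<xi> w))"

definition L0_plus :: "'w measure \<Rightarrow> ('w \<Rightarrow> real) set set" where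
  "L0_plus M = {\<xi> \<in> L0 M. L0_le M (L0_const M 0) \<xi>}"

definition L0_bar :: "'w measure \<Rightarrow> ('w \<Rightarrow> ereal) set gorder" where
  "L0_bar M = \<lparr>carrier = L0 M, eq = (=), le = L0_le M\<rparr>"

definition L0_ereal :: "'w measure \<Rightarrow> ('w \<Rightarrow> real) set \<Rightarrow> ('w \<Rightarrow> ereal) set" where
  "L0_ereal M \<xi> = L0_class M (\<lambda>w. ereal (L0_rep \<xi> w))"

lemma equiv_ae_eq: "equiv (borel_measurable M) (ae_eq M)"
proof (rule equivI)
  show "ae_eq M \<subseteq> borel_measurable M \<times> borel_measurable M"
    by (auto simp: ae_eq_def)
  show "refl_on (borel_measurable M) (ae_eq M)"
    by (auto simp: refl_on_def ae_eq_def)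
  show "sym (ae_eq M)"
    by (auto simp: sym_def ae_eq_def eq_commute)
  show "trans (ae_eq M)"
  proof (rule transI)
    fix f g h assume fgh: "(f, g) \<in> ae_eq M" "(g, h) \<in> ae_eq M"
    then have "AE w in M. f w = g w" "AE w in M. g w = h w"
      by (simp_all add: ae_eq_def)
    then have "AE w in M. f w = h w"
      by eventually_elim simp
    with fgh show "(f, h) \<in> ae_eq M"
      by (simp add: ae_eq_def)
  qed
qed

lemma L0_class_in_L0: "f \<in> borel_measurable M \<Longrightarrow> L0_class M f \<in> L0 M"
  unfolding L0_class_def L0_def by (rule quotientI)

lemma L0_rep_in:
  assumes "\<xi> \<in> L0 M" shows "L0_rep \<xi> \<in> \<xi>"
proof -
  have "\<xi> \<noteq> {}"
    using in_quotient_imp_non_empty[OF equiv_ae_eq] assms unfolding L0_def by blast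
  then show ?thesis
    unfolding L0_rep_def by (simp add: some_in_eq)
qed

lemma L0_rep_measurable: "\<xi> \<in> L0 M \<Longrightarrow> L0_rep \<xi> \<in> borel_measurable M"
  using L0_rep_in in_quotient_imp_subset[OF equiv_ae_eq] unfolding L0_def by blast

lemma L0_class_rep:
  assumes "\<xi> \<in> L0 M" shows "L0_class M (L0_rep \<xi>) = \<xi>"
proof -
  obtain f where f: "\<xi> = ae_eq M `` {f}"
    using assms unfolding L0_def by (rule quotientE)
  then have "(f, L0_rep \<xi>) \<in> ae_eq M"
    using L0_rep_in[OF assms] by blast
  from equiv_class_eq[OF equiv_ae_eq this] show ?thesis
    unfolding L0_class_def f by simp
qed

lemma L0_rep_class:
  assumes "f \<in> borel_measurable M"
  shows "AE w in M. L0_rep (L0_class M f) w = f w"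
proof -
  have "L0_rep (L0_class M f) \<in> L0_class M f"
    by (rule L0_rep_in[OF L0_class_in_L0[OF assms]])
  then have "AE w in M. f w = L0_rep (L0_class M f) w"
    unfolding L0_class_def ae_eq_def by blast
  then show ?thesis by eventually_elim simp
qed

lemma L0_class_eqI:
  assumes "f \<in> borel_measurable M" "g \<in> borel_measurable M" "AE w in M. f w = g w"
  shows "L0_class M f = L0_class M g"
  unfolding L0_class_def using assms by (intro equiv_class_eq[OF equiv_ae_eq]) (simp add: ae_eq_def)

lemma cring_L0_ring:
  "cring (L0_ring M :: ('w \<Rightarrow> 'k::{real_normed_field, second_countable_topology}) set ring)"
  (is "cring ?R")
proof -
  note [measurable] = L0_rep_measurable
  have plus: "L0_class M (\<lambda>w. L0_rep (L0_class M f) w + L0_rep (L0_class M g) w) = L0_class M (\<lambda>w. f w + g w)"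
    if [measurable]: "f \<in> borel_measurable M" "g \<in> borel_measurable M" for f g :: "'w \<Rightarrow> 'k"
  proof (rule L0_class_eqI)
    show "AE w in M. L0_rep (L0_class M f) w + L0_rep (L0_class M g) w = f w + g w"
      using L0_rep_class[OF that(1)] L0_rep_class[OF that(2)] by eventually_elim simp
  qed (use that in \<open>auto intro!: borel_measurable_add L0_rep_measurable L0_class_in_L0\<close>)
  have times: "L0_class M (\<lambda>w. L0_rep (L0_class M f) w * L0_rep (L0_class M g) w) = L0_class M (\<lambda>w. f w * g w)"
    if [measurable]: "f \<in> borel_measurable M" "g \<in> borel_measurable M" for f g :: "'w \<Rightarrow> 'k"
  proof (rule L0_class_eqI)
    show "AE w in M. L0_rep (L0_class M f) w * L0_rep (L0_class M g) w = f w * g w"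
      using L0_rep_class[OF that(1)] L0_rep_class[OF that(2)] by eventually_elim simp
  qed (use that in \<open>auto intro!: borel_measurable_times L0_rep_measurable L0_class_in_L0\<close>)
  have ex: "\<exists>f \<in> borel_measurable M. x = L0_class M f" if "x \<in> L0 M" for x :: "('w \<Rightarrow> 'k) set"
    using that L0_class_rep L0_rep_measurable by metis
  show ?thesis
  proof (rule cringI)
    show "abelian_group ?R"
    proof (rule abelian_groupI; unfold L0_ring_def L0_const_def; simp)
      fix x y z :: "('w \<Rightarrow> 'k) set"
      show "L0_class M (\<lambda>w. L0_rep x w + L0_rep y w) \<in> L0 M" if "x \<in> L0 M" "y \<in> L0 M"
        using that by (intro L0_class_in_L0) measurable
      show "L0_class M (\<lambda>_. 0 :: 'k) \<in> L0 M"
        by (intro L0_class_in_L0) measurable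
      show "L0_class M (\<lambda>w. L0_rep (L0_class M (\<lambda>w. L0_rep x w + L0_rep y w)) w + L0_rep z w) =
            L0_class M (\<lambda>w. L0_rep x w + L0_rep (L0_class M (\<lambda>w. L0_rep y w + L0_rep z w)) w)"
        if xyz: "x \<in> L0 M" "y \<in> L0 M" "z \<in> L0 M"
      proof -
        obtain f g h where [measurable]: "f \<in> borel_measurable M" "g \<in> borel_measurable M" "h \<in> borel_measurable M"
          and "x = L0_class M f" "y = L0_class M g" "z = L0_class M h"
          using ex xyz by metis
        then show ?thesis by (simp add: plus add.assoc)
      qed
      show "L0_class M (\<lambda>w. L0_rep x w + L0_rep y w) = L0_class M (\<lambda>w. L0_rep y w + L0_rep x w)"
        by (simp add: add.commute)
      show "L0_class M (\<lambda>w. L0_rep (L0_class M (\<lambda>_. 0)) w + L0_rep x w) = x" if x: "x \<in> L0 M"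
        using ex[OF x] plus[of "\<lambda>_. 0"] by auto
      show "\<exists>y\<in>L0 M. L0_class M (\<lambda>w. L0_rep y w + L0_rep x w) = L0_class M (\<lambda>_. 0)" if x: "x \<in> L0 M"
      proof -
        obtain f where f[measurable]: "f \<in> borel_measurable M" and "x = L0_class M f"
          using ex[OF x] by blast
        then show ?thesis
          using plus[of "\<lambda>w. - f w" f] by (intro bexI[of _ "L0_class M (\<lambda>w. - f w)"] L0_class_in_L0) auto
      qed
    qed
    show "comm_monoid ?R"
    proof (rule comm_monoidI; unfold L0_ring_def L0_const_def; simp)
      fix x y z :: "('w \<Rightarrow> 'k) set"
      show "L0_class M (\<lambda>w. L0_rep x w * L0_rep y w) \<in> L0 M" if "x \<in> L0 M" "y \<in> L0 M"
        using that by (intro L0_class_in_L0) measurable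
      show "L0_class M (\<lambda>_. 1 :: 'k) \<in> L0 M"
        by (intro L0_class_in_L0) measurable
      show "L0_class M (\<lambda>w. L0_rep (L0_class M (\<lambda>w. L0_rep x w * L0_rep y w)) w * L0_rep z w) =
            L0_class M (\<lambda>w. L0_rep x w * L0_rep (L0_class M (\<lambda>w. L0_rep y w * L0_rep z w)) w)"
        if xyz: "x \<in> L0 M" "y \<in> L0 M" "z \<in> L0 M"
      proof -
        obtain f g h where [measurable]: "f \<in> borel_measurable M" "g \<in> borel_measurable M" "h \<in> borel_measurable M"
          and "x = L0_class M f" "y = L0_class M g" "z = L0_class M h"
          using ex xyz by metis
        then show ?thesis by (simp add: times mult.assoc)
      qed
      show "L0_class M (\<lambda>w. L0_rep x w * L0_rep y w) = L0_class M (\<lambda>w. L0_rep y w * L0_rep x w)"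
        by (simp add: mult.commute)
      show "L0_class M (\<lambda>w. L0_rep (L0_class M (\<lambda>_. 1)) w * L0_rep x w) = x" if x: "x \<in> L0 M"
        using ex[OF x] times[of "\<lambda>_. 1"] by auto
    qed
    fix x y z
    assume "x \<in> carrier ?R" "y \<in> carrier ?R" "z \<in> carrier ?R"
    then have "x \<in> L0 M" "y \<in> L0 M" "z \<in> L0 M"
      by (simp_all add: L0_ring_def)
    then obtain f g h where [measurable]: "f \<in> borel_measurable M" "g \<in> borel_measurable M" "h \<in> borel_measurable M"
      and "x = L0_class M f" "y = L0_class M g" "z = L0_class M h"
      using ex by metis
    then show "(x \<oplus>\<^bsub>?R\<^esub> y) \<otimes>\<^bsub>?R\<^esub> z = x \<otimes>\<^bsub>?R\<^esub> z \<oplus>\<^bsub>?R\<^esub> y \<otimes>\<^bsub>?R\<^esub> z"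
      by (simp add: L0_ring_def plus times distrib_right)
  qed
qed


section \<open>Random normed modules\<close>

locale rn_module = prob_space M + Module.module "L0_ring M" X
  for M :: "'w measure"
    and X :: "(('w \<Rightarrow> 'k::{real_normed_field, second_countable_topology}) set, 'x) module" (structure) +
  fixes nrm :: "'x \<Rightarrow> ('w \<Rightarrow> real) set"
  assumes nrm_closed: "nrm \<in> carrier X \<rightarrow> L0_plus M"
    and nrm_smult: "\<lbrakk>\<xi> \<in> carrier (L0_ring M); x \<in> carrier X\<rbrakk> \<Longrightarrow>
      nrm (\<xi> \<odot>\<^bsub>X\<^esub> x) = L0_abs M \<xi> \<otimes>\<^bsub>L0_ring M\<^esub> nrm x"
    and nrm_triangle: "\<lbrakk>x \<in> carrier X; y \<in> carrier X\<rbrakk> \<Longrightarrow>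
      L0_le M (nrm (x \<oplus>\<^bsub>X\<^esub> y)) (nrm x \<oplus>\<^bsub>L0_ring M\<^esub> nrm y)"
    and nrm_zero: "\<lbrakk>x \<in> carrier X; nrm x = \<zero>\<^bsub>L0_ring M\<^esub>\<rbrakk> \<Longrightarrow> x = \<zero>\<^bsub>X\<^esub>"

text \<open>The local base at \<open>0\<close> of the \<open>(\<epsilon>, \<lambda>)\<close>-topology (with \<open>\<delta>\<close> in place of \<open>\<lambda>\<close>), and the topology itself.\<close>

definition el_nbhd ::
  "'w measure \<Rightarrow> (('w \<Rightarrow> 'k::{real_normed_field, second_countable_topology}) set, 'x) module \<Rightarrow>
   ('x \<Rightarrow> ('w \<Rightarrow> real) set) \<Rightarrow> real \<Rightarrow> real \<Rightarrow> 'x set" where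
  "el_nbhd M X nrm \<epsilon> \<delta> = {z \<in> carrier X. measure M {w \<in> space M. L0_rep (nrm z) w < \<epsilon>} > \<delta>}"

definition el_topology ::
  "'w measure \<Rightarrow> (('w \<Rightarrow> 'k::{real_normed_field, second_countable_topology}) set, 'x) module \<Rightarrow>
   ('x \<Rightarrow> ('w \<Rightarrow> real) set) \<Rightarrow> 'x topology" where
  "el_topology M X nrm = topology (\<lambda>U. U \<subseteq> carrier X \<and>
     (\<forall>x\<in>U. \<exists>\<epsilon>>0. \<exists>\<delta>\<in>{0<..<1}. \<forall>z\<in>el_nbhd M X nrm \<epsilon> \<delta>. x \<oplus>\<^bsub>X\<^esub> z \<in> U))"

text \<open>The topology is metrizable and linear, so completeness can be tested on Cauchy sequences.\<close>

definition el_complete ::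
  "'w measure \<Rightarrow> (('w \<Rightarrow> 'k::{real_normed_field, second_countable_topology}) set, 'x) module \<Rightarrow>
   ('x \<Rightarrow> ('w \<Rightarrow> real) set) \<Rightarrow> bool" where
  "el_complete M X nrm \<longleftrightarrow>
     (\<forall>\<sigma> :: nat \<Rightarrow> 'x. range \<sigma> \<subseteq> carrier X \<longrightarrow>
       (\<forall>\<epsilon>>0. \<forall>\<delta>\<in>{0<..<1}. \<exists>N. \<forall>m\<ge>N. \<forall>n\<ge>N. \<sigma> m \<ominus>\<^bsub>X\<^esub> \<sigma> n \<in> el_nbhd M X nrm \<epsilon> \<delta>) \<longrightarrow>
       (\<exists>l. limitin (el_topology M X nrm) \<sigma> l sequentially))"

lemma openin_el_topology:
  "openin (el_topology M X nrm) U \<longleftrightarrow> U \<subseteq> carrier X \<and>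
     (\<forall>x\<in>U. \<exists>\<epsilon>>0. \<exists>\<delta>\<in>{0<..<1}. \<forall>z\<in>el_nbhd M X nrm \<epsilon> \<delta>. x \<oplus>\<^bsub>X\<^esub> z \<in> U)"
  if "rn_module M X nrm"
proof -
  interpret rn_module M X nrm by (rule that)
  let ?P = "\<lambda>U. U \<subseteq> carrier X \<and>
     (\<forall>x\<in>U. \<exists>\<epsilon>>0. \<exists>\<delta>\<in>{0<..<1}. \<forall>z\<in>el_nbhd M X nrm \<epsilon> \<delta>. x \<oplus>\<^bsub>X\<^esub> z \<in> U)"
  have mono: "el_nbhd M X nrm (min \<epsilon> \<epsilon>') (max \<delta> \<delta>') \<subseteq> el_nbhd M X nrm \<epsilon> \<delta>" for \<epsilon> \<epsilon>' \<delta> \<delta>' :: real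
  proof
    fix z assume z: "z \<in> el_nbhd M X nrm (min \<epsilon> \<epsilon>') (max \<delta> \<delta>')"
    then have "nrm z \<in> L0 M"
      using nrm_closed by (auto simp: el_nbhd_def L0_plus_def)
    then have [measurable]: "L0_rep (nrm z) \<in> borel_measurable M"
      by (rule L0_rep_measurable)
    have "measure M {w \<in> space M. L0_rep (nrm z) w < min \<epsilon> \<epsilon>'} \<le> measure M {w \<in> space M. L0_rep (nrm z) w < \<epsilon>}"
      by (rule finite_measure_mono) auto
    with z show "z \<in> el_nbhd M X nrm \<epsilon> \<delta>"
      by (auto simp: el_nbhd_def)
  qed
  have "istopology ?P"
    unfolding istopology_def
  proof (intro conjI allI impI ballI)
    fix S T x assume S: "?P S" and T: "?P T" and x: "x \<in> S \<inter> T"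
    obtain \<epsilon> \<delta> where 1: "\<epsilon> > 0" "\<delta> \<in> {0<..<1}" "\<forall>z\<in>el_nbhd M X nrm \<epsilon> \<delta>. x \<oplus>\<^bsub>X\<^esub> z \<in> S"
      using S x by blast
    obtain \<epsilon>' \<delta>' where 2: "\<epsilon>' > 0" "\<delta>' \<in> {0<..<1}" "\<forall>z\<in>el_nbhd M X nrm \<epsilon>' \<delta>'. x \<oplus>\<^bsub>X\<^esub> z \<in> T"
      using T x by blast
    have "\<forall>z\<in>el_nbhd M X nrm (min \<epsilon> \<epsilon>') (max \<delta> \<delta>'). x \<oplus>\<^bsub>X\<^esub> z \<in> S \<inter> T"
      using 1(3) 2(3) mono[of \<epsilon> \<epsilon>' \<delta> \<delta>'] mono[of \<epsilon>' \<epsilon> \<delta>' \<delta>] by (auto simp: min.commute max.commute)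
    moreover have "min \<epsilon> \<epsilon>' > 0" "max \<delta> \<delta>' \<in> {0<..<1}"
      using 1(1,2) 2(1,2) by auto
    ultimately show "\<exists>\<epsilon>>0. \<exists>\<delta>\<in>{0<..<1}. \<forall>z\<in>el_nbhd M X nrm \<epsilon> \<delta>. x \<oplus>\<^bsub>X\<^esub> z \<in> S \<inter> T"
      by blast
  next
    fix \<K> x assume K: "\<forall>K\<in>\<K>. ?P K" and x: "x \<in> \<Union>\<K>"
    then obtain S where S: "S \<in> \<K>" "x \<in> S" by blast
    then have "\<exists>\<epsilon>>0. \<exists>\<delta>\<in>{0<..<1}. \<forall>z\<in>el_nbhd M X nrm \<epsilon> \<delta>. x \<oplus>\<^bsub>X\<^esub> z \<in> S"
      using K by blast
    then show "\<exists>\<epsilon>>0. \<exists>\<delta>\<in>{0<..<1}. \<forall>z\<in>el_nbhd M X nrm \<epsilon> \<delta>. x \<oplus>\<^bsub>X\<^esub> z \<in> \<Union>\<K>"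
      using S(1) by (meson UnionI)
  qed auto
  then show ?thesis
    unfolding el_topology_def by (simp add: topology_inverse')
qed

lemma topspace_el_topology:
  assumes "rn_module M X nrm" shows "topspace (el_topology M X nrm) = carrier X"
proof -
  interpret rn_module M X nrm by (rule assms)
  have "openin (el_topology M X nrm) (carrier X)"
    unfolding openin_el_topology[OF assms]
  proof (intro conjI ballI subset_refl)
    fix x assume x: "x \<in> carrier X"
    have "\<forall>z\<in>el_nbhd M X nrm 1 (1/2). x \<oplus>\<^bsub>X\<^esub> z \<in> carrier X"
      using x by (simp add: el_nbhd_def)
    moreover have "(1/2 :: real) \<in> {0<..<1}" by simp
    ultimately show "\<exists>\<epsilon>>0. \<exists>\<delta>\<in>{0<..<1}. \<forall>z\<in>el_nbhd M X nrm \<epsilon> \<delta>. x \<oplus>\<^bsub>X\<^esub> z \<in> carrier X"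
      using zero_less_one by blast
  qed
  moreover have "topspace (el_topology M X nrm) \<subseteq> carrier X"
    using openin_el_topology[OF assms] openin_topspace by blast
  ultimately show ?thesis
    by (simp add: openin_subset subset_antisym)
qed


section \<open>Almost surely bounded operators\<close>

text \<open>\<open>K\<close> acts on the module through the constant classes.\<close>

definition linear_operator ::
  "'w measure \<Rightarrow> (('w \<Rightarrow> 'k::{real_normed_field, second_countable_topology}) set, 'x) module \<Rightarrow>
   ('x \<Rightarrow> 'x) \<Rightarrow> bool" where
  "linear_operator M X T \<longleftrightarrow>
     T \<in> carrier X \<rightarrow> carrier X \<and>
     (\<forall>x\<in>carrier X. \<forall>y\<in>carrier X. T (x \<oplus>\<^bsub>X\<^esub> y) = T x \<oplus>\<^bsub>X\<^esub> T y) \<and>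
     (\<forall>c. \<forall>x\<in>carrier X. T (L0_const M c \<odot>\<^bsub>X\<^esub> x) = L0_const M c \<odot>\<^bsub>X\<^esub> T x)"

definition op_bounds ::
  "'w measure \<Rightarrow> (('w \<Rightarrow> 'k::{real_normed_field, second_countable_topology}) set, 'x) module \<Rightarrow>
   ('x \<Rightarrow> ('w \<Rightarrow> real) set) \<Rightarrow> ('x \<Rightarrow> 'x) \<Rightarrow> ('w \<Rightarrow> real) set set" where
  "op_bounds M X nrm T =
     {\<eta> \<in> L0_plus M. \<forall>z\<in>carrier X. L0_le M (nrm (T z)) (\<eta> \<otimes>\<^bsub>L0_ring M\<^esub> nrm z)}"

definition as_bounded_ops ::
  "'w measure \<Rightarrow> (('w \<Rightarrow> 'k::{real_normed_field, second_countable_topology}) set, 'x) module \<Rightarrow>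
   ('x \<Rightarrow> ('w \<Rightarrow> real) set) \<Rightarrow> ('x \<Rightarrow> 'x) set" where
  "as_bounded_ops M X nrm = {T. linear_operator M X T \<and> op_bounds M X nrm T \<noteq> {}}"

definition op_nrm ::
  "'w measure \<Rightarrow> (('w \<Rightarrow> 'k::{real_normed_field, second_countable_topology}) set, 'x) module \<Rightarrow>
   ('x \<Rightarrow> ('w \<Rightarrow> real) set) \<Rightarrow> ('x \<Rightarrow> 'x) \<Rightarrow> ('w \<Rightarrow> ereal) set" where
  "op_nrm M X nrm T = \<Sqinter>\<^bsub>L0_bar M\<^esub> (L0_ereal M ` op_bounds M X nrm T)"


section \<open>\<open>C\<close>-semigroups\<close>

text \<open>
  Functions on \<open>[0, \<infinity>)\<close> are total functions on \<^typ>\<open>real\<close>, and operators on the module are total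
  functions on \<open>'x\<close>; their values outside \<open>[0, \<infinity>)\<close> and outside the carrier are irrelevant.
\<close>

definition C_semigroup ::
  "'w measure \<Rightarrow> (('w \<Rightarrow> 'k::{real_normed_field, second_countable_topology}) set, 'x) module \<Rightarrow>
   ('x \<Rightarrow> ('w \<Rightarrow> real) set) \<Rightarrow> ('x \<Rightarrow> 'x) \<Rightarrow> (real \<Rightarrow> 'x \<Rightarrow> 'x) \<Rightarrow> bool" where
  "C_semigroup M X nrm C V \<longleftrightarrow>
     C \<in> as_bounded_ops M X nrm \<and> inj_on C (carrier X) \<and>
     (\<forall>s\<ge>0. V s \<in> as_bounded_ops M X nrm) \<and>
     (\<forall>z\<in>carrier X. continuous_map (top_of_set {0..}) (el_topology M X nrm) (\<lambda>s. V s z)) \<and>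
     (\<forall>z\<in>carrier X. V 0 z = C z) \<and>
     (\<forall>s\<ge>0. \<forall>t\<ge>0. \<forall>z\<in>carrier X. C (V (s + t) z) = V s (V t z))"

definition locally_as_bounded ::
  "'w measure \<Rightarrow> (('w \<Rightarrow> 'k::{real_normed_field, second_countable_topology}) set, 'x) module \<Rightarrow>
   ('x \<Rightarrow> ('w \<Rightarrow> real) set) \<Rightarrow> (real \<Rightarrow> 'x \<Rightarrow> 'x) \<Rightarrow> bool" where
  "locally_as_bounded M X nrm V \<longleftrightarrow>
     (\<forall>l>0. \<Squnion>\<^bsub>L0_bar M\<^esub> ((\<lambda>s. op_nrm M X nrm (V s)) ` {0..l}) \<in> L0_ereal M ` L0_plus M)"

definition diff_quot ::
  "'w measure \<Rightarrow> (('w \<Rightarrow> 'k::{real_normed_field, second_countable_topology}) set, 'x) module \<Rightarrow>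
   ('x \<Rightarrow> 'x) \<Rightarrow> (real \<Rightarrow> 'x \<Rightarrow> 'x) \<Rightarrow> 'x \<Rightarrow> real \<Rightarrow> 'x" where
  "diff_quot M X C V z s = L0_const M (of_real (1 / s)) \<odot>\<^bsub>X\<^esub> (V s z \<ominus>\<^bsub>X\<^esub> C z)"

definition gen_dom ::
  "'w measure \<Rightarrow> (('w \<Rightarrow> 'k::{real_normed_field, second_countable_topology}) set, 'x) module \<Rightarrow>
   ('x \<Rightarrow> ('w \<Rightarrow> real) set) \<Rightarrow> ('x \<Rightarrow> 'x) \<Rightarrow> (real \<Rightarrow> 'x \<Rightarrow> 'x) \<Rightarrow> 'x set" where
  "gen_dom M X nrm C V = {z \<in> carrier X.
     \<exists>y \<in> C ` carrier X. limitin (el_topology M X nrm) (diff_quot M X C V z) y (at_right 0)}"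

definition gen_op ::
  "'w measure \<Rightarrow> (('w \<Rightarrow> 'k::{real_normed_field, second_countable_topology}) set, 'x) module \<Rightarrow>
   ('x \<Rightarrow> ('w \<Rightarrow> real) set) \<Rightarrow> ('x \<Rightarrow> 'x) \<Rightarrow> (real \<Rightarrow> 'x \<Rightarrow> 'x) \<Rightarrow> 'x \<Rightarrow> 'x" where
  "gen_op M X nrm C V z = inv_into (carrier X) C
     (THE y. limitin (el_topology M X nrm) (diff_quot M X C V z) y (at_right 0))"

definition is_generator ::
  "'w measure \<Rightarrow> (('w \<Rightarrow> 'k::{real_normed_field, second_countable_topology}) set, 'x) module \<Rightarrow>
   ('x \<Rightarrow> ('w \<Rightarrow> real) set) \<Rightarrow> ('x \<Rightarrow> 'x) \<Rightarrow> (real \<Rightarrow> 'x \<Rightarrow> 'x) \<Rightarrow> ('x \<Rightarrow> 'x) \<Rightarrow> 'x set \<Rightarrow> bool" where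
  "is_generator M X nrm C V A D \<longleftrightarrow>
     D = gen_dom M X nrm C V \<and> (\<forall>z\<in>D. A z = gen_op M X nrm C V z)"

definition locally_L0_Lipschitz ::
  "'w measure \<Rightarrow> (('w \<Rightarrow> 'k::{real_normed_field, second_countable_topology}) set, 'x) module \<Rightarrow>
   ('x \<Rightarrow> ('w \<Rightarrow> real) set) \<Rightarrow> (real \<Rightarrow> 'x) \<Rightarrow> bool" where
  "locally_L0_Lipschitz M X nrm g \<longleftrightarrow>
     g \<in> {0..} \<rightarrow> carrier X \<and>
     (\<forall>l>0. \<exists>\<xi>\<in>L0_plus M. \<forall>s\<^sub>1\<in>{0..l}. \<forall>s\<^sub>2\<in>{0..l}.
       L0_le M (nrm (g s\<^sub>1 \<ominus>\<^bsub>X\<^esub> g s\<^sub>2)) (\<xi> \<otimes>\<^bsub>L0_ring M\<^esub> L0_const M \<bar>s\<^sub>1 - s\<^sub>2\<bar>))"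

end

theory Submission
  imports Defs
begin

text \<open>
  Write \<open>z = C x\<close> with \<open>x\<close> in the domain of the generator, let \<open>y\<close> be the limit of
  \<open>(V(h) x - C x) / h\<close>, and let \<open>b\<close> bound all \<open>\<parallel>V(r)\<parallel>\<close> with \<open>r \<in> [0, l]\<close>. Telescoping
  \<open>V(s + k h) z - V(s) z\<close> into the \<open>k\<close> terms \<open>V(s + i h) (V(h) x - C x)\<close> gives the bound
  \<open>k h b \<parallel>(V(h) x - C x) / h\<parallel>\<close>. With \<open>k = \<lfloor>(t - s) / h\<rfloor>\<close> and \<open>h \<rightarrow> 0\<close> in probability this becomes
  \<open>\<parallel>V(t) z - V(s) z\<parallel> \<le> b \<parallel>y\<parallel> (t - s)\<close>, and applying the bounded operator \<open>C\<close> only costs a factor.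
  No mean value theorem is available: a path with zero derivative in probability, such as
  \<open>s \<mapsto> 1\<^bsub>[0, s]\<^esub>\<close> on the unit interval, need not be constant.
\<close>

section \<open>Essential suprema and the lattice of extended random variables\<close>

text \<open>A bounded, strictly increasing Borel function on the extended reals: expectations become
  finite, and a strict increase of a supremum stays visible in them.\<close>

definition ereal_arctan :: "ereal \<Rightarrow> real" where
  "ereal_arctan x = (if x = \<infinity> then pi / 2 else if x = - \<infinity> then - (pi / 2) else arctan (real_of_ereal x))"

lemma ereal_arctan_measurable [measurable]: "ereal_arctan \<in> borel_measurable borel"
  unfolding ereal_arctan_def by measurable

lemma ereal_arctan_less:
  assumes "x < y" shows "ereal_arctan x < ereal_arctan y"
  using assms arctan_bounded
  by (cases x; cases y) (auto simp: ereal_arctan_def arctan_less_iff)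

lemma ereal_arctan_mono: "x \<le> y \<Longrightarrow> ereal_arctan x \<le> ereal_arctan y"
  using ereal_arctan_less by (cases "x = y") (auto simp: less_le)

lemma abs_ereal_arctan_le: "\<bar>ereal_arctan x\<bar> \<le> pi / 2"
  using arctan_bounded[of "real_of_ereal x"] by (auto simp: ereal_arctan_def abs_le_iff)

text \<open>
  A countable subfamily whose pointwise supremum maximises the expectation of the arctangent
  attains the essential supremum.
\<close>

lemma (in prob_space) ex_essential_supremum:
  fixes F :: "('a \<Rightarrow> ereal) set"
  assumes F: "F \<subseteq> borel_measurable M"
  shows "\<exists>g \<in> borel_measurable M. (\<forall>f\<in>F. AE w in M. f w \<le> g w) \<and>
    (\<forall>h. (\<forall>f\<in>F. AE w in M. f w \<le> h w) \<longrightarrow> (AE w in M. g w \<le> h w))"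
proof -
  define S where "S = {C. countable C \<and> C \<subseteq> F}"
  define I where "I C = expectation (\<lambda>w. ereal_arctan (SUP f\<in>C. f w))" for C
  have meas: "(\<lambda>w. SUP f\<in>C. f w) \<in> borel_measurable M" if "C \<in> S" for C
    using that F by (intro borel_measurable_SUP) (auto simp: S_def)
  have int: "integrable M (\<lambda>w. ereal_arctan (SUP f\<in>C. f w))" if "C \<in> S" for C
  proof (rule integrable_const_bound)
    show "AE w in M. norm (ereal_arctan (SUP f\<in>C. f w)) \<le> pi / 2"
      by (intro AE_I2) (simp only: real_norm_def abs_ereal_arctan_le)
  qed (use meas[OF that] in measurable)
  have I_mono: "I C \<le> I C'" if "C \<subseteq> C'" "C \<in> S" "C' \<in> S" for C C'
    unfolding I_def using that
    by (intro integral_mono int ereal_arctan_mono SUP_subset_mono) auto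
  have I_le: "I C \<le> pi / 2" if "C \<in> S" for C
  proof -
    have "I C \<le> expectation (\<lambda>_. pi / 2)"
      unfolding I_def
      by (rule integral_mono[OF int[OF that]]) (simp, rule abs_le_D1[OF abs_ereal_arctan_le])
    then show ?thesis by (simp add: prob_space)
  qed
  have bdd: "bdd_above (I ` S)" using I_le by (intro bdd_aboveI2)
  have ne: "I ` S \<noteq> {}" by (auto simp: S_def)
  have "\<exists>C\<in>S. Sup (I ` S) - inverse (real (Suc n)) < I C" for n
    using less_cSup_iff[OF ne bdd, of "Sup (I ` S) - inverse (real (Suc n))"] by auto
  then obtain c where c: "\<And>n. c n \<in> S" "\<And>n. Sup (I ` S) - inverse (real (Suc n)) < I (c n)"
    by metis
  define C where "C = (\<Union>n. c n)"
  have CS: "C \<in> S" using c(1) by (auto simp: C_def S_def)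
  have "Sup (I ` S) \<le> I C + inverse (real (Suc n))" for n
  proof -
    have "I (c n) \<le> I C" using c(1) CS by (intro I_mono) (auto simp: C_def)
    with c(2)[of n] show ?thesis by simp
  qed
  then have "Sup (I ` S) \<le> I C + 0"
    by (intro LIMSEQ_le_const[OF tendsto_add[OF tendsto_const LIMSEQ_inverse_real_of_nat]]) blast
  then have Sup_le: "Sup (I ` S) \<le> I C" by simp
  define g where "g w = (SUP f\<in>C. f w)" for w
  show ?thesis
  proof (intro bexI[of _ g] conjI ballI allI impI)
    show "g \<in> borel_measurable M" unfolding g_def by (rule meas[OF CS])
    fix f assume f: "f \<in> F"
    \<comment> \<open>Adding \<open>f\<close> cannot raise the maximal value of \<open>I\<close>, so
      the two arctangents agree almost surely, and strict monotonicity makes the suprema themselves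
      agree.\<close>
    define C' where "C' = insert f C"
    have C'S: "C' \<in> S" using f CS by (auto simp: C'_def S_def)
    let ?d = "\<lambda>w. ereal_arctan (SUP f\<in>C'. f w) - ereal_arctan (SUP f\<in>C. f w)"
    have le: "(SUP f\<in>C. f w) \<le> (SUP f\<in>C'. f w)" for w
      by (rule SUP_subset_mono) (auto simp: C'_def)
    have "I C' \<le> I C"
      using Sup_le cSUP_upper[OF C'S bdd] by simp
    then have "expectation ?d \<le> 0"
      using int[OF CS] int[OF C'S] by (simp add: I_def)
    moreover have "0 \<le> expectation ?d"
      by (intro Bochner_Integration.integral_nonneg) (simp add: ereal_arctan_mono le)
    ultimately have "AE w in M. ?d w = 0"
      using int[OF CS] int[OF C'S]
      by (subst integral_nonneg_eq_0_iff_AE[symmetric]) (auto simp: ereal_arctan_mono le)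
    then show "AE w in M. f w \<le> g w"
    proof eventually_elim
      case (elim w)
      have "(SUP f\<in>C'. f w) = (SUP f\<in>C. f w)"
        using elim le[of w] ereal_arctan_less[of "SUP f\<in>C. f w" "SUP f\<in>C'. f w"] by (auto simp: le_less)
      moreover have "f w \<le> (SUP f\<in>C'. f w)" by (rule SUP_upper) (simp add: C'_def)
      ultimately show ?case by (simp add: g_def)
    qed
  next
    fix h assume "\<forall>f\<in>F. AE w in M. f w \<le> h w"
    \<comment> \<open>Countability of \<open>C\<close> merges the exceptional null sets of its
      members into one.\<close>
    then have "AE w in M. \<forall>f\<in>C. f w \<le> h w"
      using CS by (subst AE_ball_countable) (auto simp: S_def)
    then show "AE w in M. g w \<le> h w"
      by eventually_elim (auto simp: g_def intro: SUP_least)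
  qed
qed

text \<open>The lattice supremum is a \<open>SOME\<close> term, so it has its defining property as
  soon as one least upper bound exists; the class of the essential supremum of the representatives
  is one.\<close>

lemma (in prob_space) least_L0_bar_sup:
  assumes A: "A \<subseteq> L0 M"
  shows "least (L0_bar M) (\<Squnion>\<^bsub>L0_bar M\<^esub> A) (Upper (L0_bar M) A)"
proof -
  have "L0_rep ` A \<subseteq> borel_measurable M"
    using A L0_rep_measurable by blast
  from ex_essential_supremum[OF this] obtain g where g: "g \<in> borel_measurable M"
    "\<And>\<xi>. \<xi> \<in> A \<Longrightarrow> AE w in M. L0_rep \<xi> w \<le> g w"
    "\<And>h. (\<And>\<xi>. \<xi> \<in> A \<Longrightarrow> AE w in M. L0_rep \<xi> w \<le> h w) \<Longrightarrow> AE w in M. g w \<le> h w"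
    by auto
  have eq: "AE w in M. L0_rep (L0_class M g) w = g w" by (rule L0_rep_class[OF g(1)])
  have "L0_le M \<xi> (L0_class M g)" if "\<xi> \<in> A" for \<xi>
    unfolding L0_le_def using g(2)[OF that] eq by eventually_elim simp
  moreover have "L0_le M (L0_class M g) \<eta>" if "\<And>\<xi>. \<xi> \<in> A \<Longrightarrow> L0_le M \<xi> \<eta>" for \<eta>
  proof -
    have "AE w in M. g w \<le> L0_rep \<eta> w"
      by (rule g(3)) (use that in \<open>simp add: L0_le_def\<close>)
    with eq show ?thesis unfolding L0_le_def by eventually_elim simp
  qed
  ultimately have "least (L0_bar M) (L0_class M g) (Upper (L0_bar M) A)"
    using L0_class_in_L0[OF g(1)] A by (auto simp: least_def Upper_def L0_bar_def)
  then show ?thesis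
    unfolding sup_def by (rule someI)
qed

text \<open>Every member of \<open>A\<close> is an upper bound of the set of lower bounds, so the
  supremum of that set is itself a lower bound, and the greatest one.\<close>

lemma (in prob_space) greatest_L0_bar_inf:
  assumes A: "A \<subseteq> L0 M"
  shows "greatest (L0_bar M) (\<Sqinter>\<^bsub>L0_bar M\<^esub> A) (Lower (L0_bar M) A)"
proof -
  let ?L = "Lower (L0_bar M) A"
  have "?L \<subseteq> L0 M" by (auto simp: Lower_def L0_bar_def)
  from least_L0_bar_sup[OF this] A
  have "greatest (L0_bar M) (\<Squnion>\<^bsub>L0_bar M\<^esub> ?L) ?L"
    by (auto simp: least_def greatest_def Upper_def Lower_def L0_bar_def)
  then show ?thesis
    unfolding inf_def by (rule someI)
qed

section \<open>Almost sure computation with representatives\<close>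

lemma L0_rep_mult:
  fixes \<xi> \<eta> :: "('w \<Rightarrow> 'k::{real_normed_field, second_countable_topology}) set"
  assumes [measurable]: "L0_rep \<xi> \<in> borel_measurable M" "L0_rep \<eta> \<in> borel_measurable M"
  shows "AE w in M. L0_rep (\<xi> \<otimes>\<^bsub>L0_ring M\<^esub> \<eta>) w = L0_rep \<xi> w * L0_rep \<eta> w"
  unfolding L0_ring_def by (simp, rule L0_rep_class) measurable

lemma L0_rep_add:
  fixes \<xi> \<eta> :: "('w \<Rightarrow> 'k::{real_normed_field, second_countable_topology}) set"
  assumes [measurable]: "L0_rep \<xi> \<in> borel_measurable M" "L0_rep \<eta> \<in> borel_measurable M"
  shows "AE w in M. L0_rep (\<xi> \<oplus>\<^bsub>L0_ring M\<^esub> \<eta>) w = L0_rep \<xi> w + L0_rep \<eta> w"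
  unfolding L0_ring_def by (simp, rule L0_rep_class) measurable

lemma L0_rep_const: "AE w in M. L0_rep (L0_const M c) w = c"
  unfolding L0_const_def by (rule L0_rep_class) measurable

lemma L0_const_in_L0: "L0_const M c \<in> L0 M"
  unfolding L0_const_def by (rule L0_class_in_L0) measurable

lemma L0_plus_rep_measurable: "\<xi> \<in> L0_plus M \<Longrightarrow> L0_rep \<xi> \<in> borel_measurable M"
  by (auto simp: L0_plus_def intro: L0_rep_measurable)

lemma L0_plus_rep_nonneg: "\<xi> \<in> L0_plus M \<Longrightarrow> AE w in M. 0 \<le> L0_rep \<xi> w"
  using L0_rep_const[of M "0::real"] by (auto simp: L0_plus_def L0_le_def)

lemma L0_class_plusI:
  assumes f: "f \<in> borel_measurable M" and "AE w in M. 0 \<le> f w"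
  shows "L0_class M f \<in> L0_plus M"
proof -
  have "L0_le M (L0_const M 0) (L0_class M f)"
    unfolding L0_le_def
    using L0_rep_const[of M "0::real"] L0_rep_class[OF f] assms(2) by eventually_elim simp
  then show ?thesis using L0_class_in_L0[OF f] by (simp add: L0_plus_def)
qed

lemma L0_ereal_in_L0:
  assumes "\<xi> \<in> L0_plus M" shows "L0_ereal M \<xi> \<in> L0 M"
  unfolding L0_ereal_def using L0_plus_rep_measurable[OF assms, measurable]
  by (intro L0_class_in_L0) measurable

lemma L0_rep_ereal:
  assumes "\<xi> \<in> L0_plus M" shows "AE w in M. L0_rep (L0_ereal M \<xi>) w = ereal (L0_rep \<xi> w)"
  unfolding L0_ereal_def using L0_plus_rep_measurable[OF assms, measurable]
  by (intro L0_rep_class) measurable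

lemma L0_le_trans: "L0_le M \<xi> \<eta> \<Longrightarrow> L0_le M \<eta> \<zeta> \<Longrightarrow> L0_le M \<xi> \<zeta>"
  for \<xi> \<eta> \<zeta> :: "('w \<Rightarrow> 'b::{topological_space, preorder}) set"
  unfolding L0_le_def by (auto elim: eventually_elim2 intro: order_trans)

section \<open>Events of probability close to one\<close>

text \<open>Convergence in probability controls an inequality only up to a small exceptional event;
  once the loss can be made arbitrarily small, the inequality holds almost surely.\<close>

lemma (in prob_space) AE_if_prob_ge:
  assumes Q: "{w \<in> space M. Q w} \<in> events"
    and ge: "\<And>\<delta>. 0 < \<delta> \<Longrightarrow> 1 - \<delta> \<le> prob {w \<in> space M. Q w}"
  shows "AE w in M. Q w"
proof -
  have "1 \<le> prob {w \<in> space M. Q w}"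
    by (rule field_le_epsilon) (use ge in force)
  then have "prob {w \<in> space M. Q w} = 1"
    by (simp add: antisym)
  then show ?thesis using Q by (simp add: prob_Collect_eq_1)
qed

text \<open>Inclusion-exclusion, with the probability of the union at most 1. It lets two
  approximations hold on a common event.\<close>

lemma (in prob_space) prob_conj_ge:
  assumes P: "{w \<in> space M. P w} \<in> events" and Q: "{w \<in> space M. Q w} \<in> events"
  shows "prob {w \<in> space M. P w} + prob {w \<in> space M. Q w} - 1 \<le> prob {w \<in> space M. P w \<and> Q w}"
proof -
  have "{w \<in> space M. P w \<and> Q w} = {w \<in> space M. P w} \<inter> {w \<in> space M. Q w}" by auto
  moreover have "prob ({w \<in> space M. P w} \<union> {w \<in> space M. Q w}) \<le> 1" by simp
  ultimately show ?thesis
    using finite_measure_Union'[OF P Q] finite_measure_Diff'[OF Q P]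
    by (simp add: Int_commute)
qed

text \<open>Links limits along the filter of the abstract topology to \<open>at a within S\<close>,
  which has a metric description.\<close>

lemma atin_within_euclidean: "atin_within euclidean a S = (at a within S)"
  by (simp add: filter_eq_iff eventually_atin_within eventually_at_topological)
    (metis (no_types))

section \<open>Norm inequalities on representatives\<close>

context rn_module
begin

abbreviation N :: "'x \<Rightarrow> 'w \<Rightarrow> real" where
  "N x \<equiv> L0_rep (nrm x)"

lemma nrm_in_L0_plus: "x \<in> carrier X \<Longrightarrow> nrm x \<in> L0_plus M"
  using nrm_closed by blast

lemma N_measurable [measurable (raw)]: "x \<in> carrier X \<Longrightarrow> N x \<in> borel_measurable M"
  by (rule L0_plus_rep_measurable[OF nrm_in_L0_plus])

lemma N_nonneg: "x \<in> carrier X \<Longrightarrow> AE w in M. 0 \<le> N x w"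
  by (rule L0_plus_rep_nonneg[OF nrm_in_L0_plus])

lemma N_triangle:
  assumes "x \<in> carrier X" "y \<in> carrier X"
  shows "AE w in M. N (x \<oplus>\<^bsub>X\<^esub> y) w \<le> N x w + N y w"
  using nrm_triangle[OF assms, unfolded L0_le_def]
    L0_rep_add[OF N_measurable N_measurable, OF assms]
  by eventually_elim simp

lemma const_in_ring: "L0_const M c \<in> carrier (L0_ring M)"
  by (simp add: L0_ring_def L0_const_in_L0)

lemma N_const_smult:
  assumes x: "x \<in> carrier X"
  shows "AE w in M. N (L0_const M c \<odot>\<^bsub>X\<^esub> x) w = norm c * N x w"
proof -
  have [measurable]: "L0_rep (L0_const M c) \<in> borel_measurable M"
    by (rule L0_rep_measurable[OF L0_const_in_L0])
  have "L0_abs M (L0_const M c) \<in> L0 M"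
    unfolding L0_abs_def by (rule L0_class_in_L0) measurable
  then have [measurable]: "L0_rep (L0_abs M (L0_const M c)) \<in> borel_measurable M"
    by (rule L0_rep_measurable)
  have "AE w in M. L0_rep (L0_abs M (L0_const M c)) w = norm (L0_rep (L0_const M c) w)"
    unfolding L0_abs_def by (rule L0_rep_class) measurable
  moreover have "AE w in M. L0_rep (L0_const M c) w = c"
    by (rule L0_rep_const)
  moreover have "AE w in M. N (L0_const M c \<odot>\<^bsub>X\<^esub> x) w = L0_rep (L0_abs M (L0_const M c)) w * N x w"
    unfolding nrm_smult[OF const_in_ring x] by (rule L0_rep_mult) (use x in measurable)
  ultimately show ?thesis by eventually_elim simp
qed

lemma N_zero: "AE w in M. N \<zero>\<^bsub>X\<^esub> w = 0"
proof -
  have "L0_const M 0 \<odot>\<^bsub>X\<^esub> \<zero>\<^bsub>X\<^esub> = \<zero>\<^bsub>X\<^esub>"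
    using smult_r_null[OF const_in_ring] by simp
  then show ?thesis using N_const_smult[OF M.zero_closed, of 0] by simp
qed

text \<open>The norm axiom speaks about scalar multiples, so the group inverse is first identified
  with multiplication by the class of \<open>-1\<close>.\<close>

lemma N_uminus:
  assumes x: "x \<in> carrier X" shows "AE w in M. N (\<ominus>\<^bsub>X\<^esub> x) w = N x w"
proof -
  let ?u = "L0_const M (-1) \<odot>\<^bsub>X\<^esub> x"
  have c: "?u \<in> carrier X" by (rule smult_closed[OF const_in_ring x])
  have "L0_const M (1::'k) \<oplus>\<^bsub>L0_ring M\<^esub> L0_const M (-1) = L0_const M 0"
  proof -
    note [measurable] = L0_rep_measurable[OF L0_const_in_L0]
    have "L0_class M (\<lambda>w. L0_rep (L0_const M 1) w + L0_rep (L0_const M (-1)) w) = L0_class M (\<lambda>_. 0::'k)"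
    proof (rule L0_class_eqI)
      show "AE w in M. L0_rep (L0_const M 1) w + L0_rep (L0_const M (-1)) w = (0::'k)"
        using L0_rep_const[of M "1::'k"] L0_rep_const[of M "-1::'k"] by eventually_elim simp
    qed measurable
    then show ?thesis by (simp add: L0_ring_def L0_const_def)
  qed
  moreover have "L0_const M (1::'k) = \<one>\<^bsub>L0_ring M\<^esub>" "L0_const M (0::'k) = \<zero>\<^bsub>L0_ring M\<^esub>"
    by (simp_all add: L0_ring_def)
  ultimately have "x \<oplus>\<^bsub>X\<^esub> ?u = \<zero>\<^bsub>X\<^esub>"
    using smult_l_distr[OF const_in_ring const_in_ring x, of 1 "-1"] x by simp
  then have "\<ominus>\<^bsub>X\<^esub> x = ?u"
    using M.minus_equality[of ?u x] c x by (simp add: M.a_comm)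
  then show ?thesis using N_const_smult[OF x, of "-1"] by simp
qed

lemma N_minus_commute:
  assumes "x \<in> carrier X" "y \<in> carrier X"
  shows "AE w in M. N (x \<ominus>\<^bsub>X\<^esub> y) w = N (y \<ominus>\<^bsub>X\<^esub> x) w"
proof -
  have "\<ominus>\<^bsub>X\<^esub> (x \<ominus>\<^bsub>X\<^esub> y) = y \<ominus>\<^bsub>X\<^esub> x"
    using assms by (simp add: a_minus_def M.minus_add M.a_comm)
  then show ?thesis using N_uminus[of "x \<ominus>\<^bsub>X\<^esub> y"] assms by fastforce
qed

lemma minus_add_minus:
  assumes "x \<in> carrier X" "y \<in> carrier X" "z \<in> carrier X"
  shows "(x \<ominus>\<^bsub>X\<^esub> y) \<oplus>\<^bsub>X\<^esub> (y \<ominus>\<^bsub>X\<^esub> z) = x \<ominus>\<^bsub>X\<^esub> z"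
  using assms by (simp add: a_minus_def M.a_assoc M.r_neg1)

lemma N_minus_triangle:
  assumes "x \<in> carrier X" "y \<in> carrier X" "z \<in> carrier X"
  shows "AE w in M. N (x \<ominus>\<^bsub>X\<^esub> z) w \<le> N (x \<ominus>\<^bsub>X\<^esub> y) w + N (y \<ominus>\<^bsub>X\<^esub> z) w"
  using N_triangle[of "x \<ominus>\<^bsub>X\<^esub> y" "y \<ominus>\<^bsub>X\<^esub> z"] assms by (simp add: minus_add_minus)

section \<open>Neighbourhoods and limits in the (epsilon, lambda)-topology\<close>

text \<open>Both inequalities defining the neighbourhood are strict. Lowering the threshold by a
  small \<open>1 / (n + 1)\<close> keeps the probability above \<open>\<delta>\<close>, by
  continuity of the measure from below, and the triangle inequality spends this slack on the
  perturbation \<open>z\<close>.\<close>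

lemma openin_translate_el_nbhd:
  assumes x: "x \<in> carrier X" and "\<delta> \<in> {0<..<1}"
  shows "openin (el_topology M X nrm) {y \<in> carrier X. y \<ominus>\<^bsub>X\<^esub> x \<in> el_nbhd M X nrm \<epsilon> \<delta>}"
  unfolding openin_el_topology[OF rn_module_axioms]
proof (intro conjI ballI)
  fix y assume "y \<in> {y \<in> carrier X. y \<ominus>\<^bsub>X\<^esub> x \<in> el_nbhd M X nrm \<epsilon> \<delta>}"
  then have y: "y \<in> carrier X" and gt: "prob {w \<in> space M. N (y \<ominus>\<^bsub>X\<^esub> x) w < \<epsilon>} > \<delta>"
    by (auto simp: el_nbhd_def)
  have d: "y \<ominus>\<^bsub>X\<^esub> x \<in> carrier X" using x y by simp
  note [measurable] = N_measurable[OF d]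
  define E where "E n = {w \<in> space M. N (y \<ominus>\<^bsub>X\<^esub> x) w < \<epsilon> - inverse (real (Suc n))}" for n
  have "(\<Union>n. E n) = {w \<in> space M. N (y \<ominus>\<^bsub>X\<^esub> x) w < \<epsilon>}"
  proof (intro equalityI subsetI)
    fix w assume w: "w \<in> {w \<in> space M. N (y \<ominus>\<^bsub>X\<^esub> x) w < \<epsilon>}"
    then obtain n where "inverse (real (Suc n)) < \<epsilon> - N (y \<ominus>\<^bsub>X\<^esub> x) w"
      using reals_Archimedean[of "\<epsilon> - N (y \<ominus>\<^bsub>X\<^esub> x) w"] by auto
    with w show "w \<in> (\<Union>n. E n)" by (auto simp: E_def intro!: exI[of _ n])
  next
    fix w assume "w \<in> (\<Union>n. E n)"
    then obtain n where "w \<in> space M" "N (y \<ominus>\<^bsub>X\<^esub> x) w < \<epsilon> - inverse (real (Suc n))"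
      by (auto simp: E_def)
    moreover have "0 < inverse (real (Suc n))" by simp
    ultimately show "w \<in> {w \<in> space M. N (y \<ominus>\<^bsub>X\<^esub> x) w < \<epsilon>}"
      by (intro CollectI conjI) (assumption, linarith)
  qed
  moreover have "incseq E"
  proof (rule incseq_SucI)
    fix n
    have "inverse (real (Suc (Suc n))) \<le> inverse (real (Suc n))" by (rule le_imp_inverse_le) auto
    then show "E n \<subseteq> E (Suc n)"
      unfolding E_def by (intro Collect_mono) (metis diff_left_mono less_le_trans)
  qed
  moreover have "range E \<subseteq> events" by (auto simp: E_def)
  ultimately have "(\<lambda>n. prob (E n)) \<longlonglongrightarrow> prob {w \<in> space M. N (y \<ominus>\<^bsub>X\<^esub> x) w < \<epsilon>}"
    using finite_Lim_measure_incseq[of E] by simp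
  from order_tendstoD(1)[OF this gt] obtain n where n: "\<delta> < prob (E n)"
    by (auto simp: eventually_sequentially)
  \<comment> \<open>\<open>?p\<close> is chosen so that the event for \<open>z\<close> misses less
    than \<open>prob (E n) - \<delta>\<close>; its intersection with \<open>E n\<close> still has
    probability above \<open>\<delta>\<close>.\<close>
  let ?r = "inverse (real (Suc n))" and ?p = "1 - (prob (E n) - \<delta>)"
  have "y \<oplus>\<^bsub>X\<^esub> z \<in> {y \<in> carrier X. y \<ominus>\<^bsub>X\<^esub> x \<in> el_nbhd M X nrm \<epsilon> \<delta>}" if z: "z \<in> el_nbhd M X nrm ?r ?p" for z
  proof -
    have zc: "z \<in> carrier X" and zp: "prob {w \<in> space M. N z w < ?r} > ?p"
      using z by (auto simp: el_nbhd_def)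
    note [measurable] = N_measurable[OF zc]
    have c: "(y \<oplus>\<^bsub>X\<^esub> z) \<ominus>\<^bsub>X\<^esub> x \<in> carrier X" using x y zc by simp
    note [measurable] = N_measurable[OF c]
    have eq: "(y \<ominus>\<^bsub>X\<^esub> x) \<oplus>\<^bsub>X\<^esub> z = (y \<oplus>\<^bsub>X\<^esub> z) \<ominus>\<^bsub>X\<^esub> x"
      using x y zc by (simp add: a_minus_def M.a_ac)
    have "\<delta> < prob (E n) + prob {w \<in> space M. N z w < ?r} - 1" using zp by simp
    also have "\<dots> \<le> prob {w \<in> space M. N (y \<ominus>\<^bsub>X\<^esub> x) w < \<epsilon> - ?r \<and> N z w < ?r}"
      unfolding E_def by (rule prob_conj_ge) measurable
    also have "\<dots> \<le> prob {w \<in> space M. N ((y \<oplus>\<^bsub>X\<^esub> z) \<ominus>\<^bsub>X\<^esub> x) w < \<epsilon>}"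
    proof (rule finite_measure_mono_AE)
      show "AE w in M. w \<in> {w \<in> space M. N (y \<ominus>\<^bsub>X\<^esub> x) w < \<epsilon> - ?r \<and> N z w < ?r} \<longrightarrow>
          w \<in> {w \<in> space M. N ((y \<oplus>\<^bsub>X\<^esub> z) \<ominus>\<^bsub>X\<^esub> x) w < \<epsilon>}"
        using N_triangle[OF d zc] unfolding eq by eventually_elim auto
    qed measurable
    finally show ?thesis using c y zc by (simp add: el_nbhd_def)
  qed
  moreover have "?r > 0" "?p \<in> {0<..<1}" using n assms(2) prob_le_1[of "E n"] by (simp, unfold greaterThanLessThan_iff, linarith)
  ultimately show "\<exists>\<epsilon>'>0. \<exists>\<delta>'\<in>{0<..<1}. \<forall>z\<in>el_nbhd M X nrm \<epsilon>' \<delta>'.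
      y \<oplus>\<^bsub>X\<^esub> z \<in> {y \<in> carrier X. y \<ominus>\<^bsub>X\<^esub> x \<in> el_nbhd M X nrm \<epsilon> \<delta>}"
    by blast
qed auto

lemma minus_self_in_el_nbhd:
  assumes "x \<in> carrier X" "0 < \<epsilon>" "\<delta> < 1"
  shows "x \<ominus>\<^bsub>X\<^esub> x \<in> el_nbhd M X nrm \<epsilon> \<delta>"
proof -
  note [measurable] = N_measurable[OF M.zero_closed]
  have "AE w in M. N \<zero>\<^bsub>X\<^esub> w < \<epsilon>"
    using N_zero by eventually_elim (simp add: assms)
  then have "prob {w \<in> space M. N \<zero>\<^bsub>X\<^esub> w < \<epsilon>} = 1"
    by (subst prob_Collect_eq_1) measurable
  then show ?thesis
    using assms by (simp add: el_nbhd_def a_minus_def M.r_neg)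
qed

text \<open>A \<open>limitin\<close> assertion speaks about open sets, and the translated
  neighbourhood of \<open>l\<close> is one; limits are used below in this form, as convergence in
  probability.\<close>

lemma limitin_el_nbhd:
  assumes lim: "limitin (el_topology M X nrm) f l F" and "0 < \<epsilon>" "\<delta> \<in> {0<..<1}"
  shows "eventually (\<lambda>t. f t \<ominus>\<^bsub>X\<^esub> l \<in> el_nbhd M X nrm \<epsilon> \<delta>) F"
proof -
  have l: "l \<in> carrier X"
    using limitin_topspace[OF lim] by (simp add: topspace_el_topology[OF rn_module_axioms])
  let ?U = "{y \<in> carrier X. y \<ominus>\<^bsub>X\<^esub> l \<in> el_nbhd M X nrm \<epsilon> \<delta>}"
  have "eventually (\<lambda>t. f t \<in> ?U) F"
  proof (rule lim[unfolded limitin_def, THEN conjunct2, rule_format], intro conjI)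
    show "openin (el_topology M X nrm) ?U"
      by (rule openin_translate_el_nbhd[OF l assms(3)])
    show "l \<in> ?U"
      using l assms minus_self_in_el_nbhd[OF l assms(2), of \<delta>] by simp
  qed
  then show ?thesis by eventually_elim simp
qed

section \<open>Almost surely bounded operators and their norms\<close>

lemma op_bounds_AE:
  assumes "b \<in> op_bounds M X nrm T" "x \<in> carrier X"
  shows "AE w in M. N (T x) w \<le> L0_rep b w * N x w"
proof -
  have b: "b \<in> L0_plus M" and le: "L0_le M (nrm (T x)) (b \<otimes>\<^bsub>L0_ring M\<^esub> nrm x)"
    using assms by (auto simp: op_bounds_def)
  from le[unfolded L0_le_def] L0_rep_mult[OF L0_plus_rep_measurable[OF b] N_measurable[OF assms(2)]]
  show ?thesis by eventually_elim simp
qed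

lemma op_nrm_in_L0: "op_nrm M X nrm T \<in> L0 M"
proof -
  have "L0_ereal M ` op_bounds M X nrm T \<subseteq> L0 M"
    using L0_ereal_in_L0 by (auto simp: op_bounds_def)
  from greatest_L0_bar_inf[OF this] show ?thesis
    by (auto simp: op_nrm_def greatest_def Lower_def L0_bar_def)
qed

text \<open>
  For each \<open>x\<close> the quotient \<open>\<parallel>T x\<parallel> / \<parallel>x\<parallel>\<close>, set to \<open>- \<infinity>\<close> where \<open>\<parallel>x\<parallel> = 0\<close>, is a lower bound of the
  set of bounds of \<open>T\<close>; hence the infimum \<open>\<parallel>T\<parallel>\<close> is itself a bound.
\<close>

lemma op_boundsI_op_nrm:
  assumes T: "T \<in> as_bounded_ops M X nrm" and b: "b \<in> L0_plus M"
    and le: "L0_le M (op_nrm M X nrm T) (L0_ereal M b)"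
  shows "b \<in> op_bounds M X nrm T"
proof -
  have "L0_le M (nrm (T x)) (b \<otimes>\<^bsub>L0_ring M\<^esub> nrm x)" if x: "x \<in> carrier X" for x
  proof -
    have Tx: "T x \<in> carrier X"
      using T x by (auto simp: as_bounded_ops_def linear_operator_def)
    note [measurable] = N_measurable[OF x] N_measurable[OF Tx]
    define r where "r w = (if N x w > 0 then ereal (N (T x) w / N x w) else - \<infinity>)" for w
    have r: "r \<in> borel_measurable M" unfolding r_def by measurable
    have low: "L0_le M (L0_class M r) (L0_ereal M \<eta>)" if \<eta>: "\<eta> \<in> op_bounds M X nrm T" for \<eta>
    proof -
      have "\<eta> \<in> L0_plus M" using \<eta> by (simp add: op_bounds_def)
      from L0_rep_ereal[OF this] op_bounds_AE[OF \<eta> x] L0_rep_class[OF r] show ?thesis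
        unfolding L0_le_def by eventually_elim (simp add: r_def divide_le_eq)
    qed
    have sub: "L0_ereal M ` op_bounds M X nrm T \<subseteq> L0 M"
      using L0_ereal_in_L0 by (auto simp: op_bounds_def)
    have "L0_le M (L0_class M r) (op_nrm M X nrm T)"
      using greatest_L0_bar_inf[OF sub] low L0_class_in_L0[OF r]
      by (auto simp: op_nrm_def greatest_def Lower_def L0_bar_def)
    from L0_le_trans[OF this le]
    have "AE w in M. L0_rep (L0_class M r) w \<le> L0_rep (L0_ereal M b) w"
      by (simp add: L0_le_def)
    \<comment> \<open>Where \<open>N x\<close> vanishes, the value \<open>-\<infinity>\<close> of
      \<open>r\<close> carries no information; there any bound of \<open>T\<close> forces
      \<open>N (T x) w \<le> 0\<close>.\<close>
    moreover have "AE w in M. N x w = 0 \<longrightarrow> N (T x) w \<le> 0"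
    proof -
      obtain \<eta> where "\<eta> \<in> op_bounds M X nrm T" using T by (auto simp: as_bounded_ops_def)
      from op_bounds_AE[OF this x] show ?thesis by eventually_elim auto
    qed
    ultimately show ?thesis
      unfolding L0_le_def
      using L0_rep_ereal[OF b] L0_rep_class[OF r] N_nonneg[OF x]
        L0_rep_mult[OF L0_plus_rep_measurable[OF b] N_measurable[OF x]]
    proof eventually_elim
      case (elim w)
      show ?case
      proof (cases "N x w = 0")
        case False
        then have "N x w > 0" using elim by simp
        with elim show ?thesis by (simp add: r_def divide_le_eq)
      qed (use elim in simp)
    qed
  qed
  with b show ?thesis by (simp add: op_bounds_def)
qed

text \<open>By hypothesis the supremum of the norms comes from a real-valued class \<open>b\<close>.
  It dominates each single norm, so \<open>b\<close> is a bound of each \<open>V s\<close>, with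
  null sets that may depend on \<open>s\<close> and on the vector.\<close>

lemma locally_as_bounded_op_bounds:
  assumes V: "\<And>s. 0 \<le> s \<Longrightarrow> V s \<in> as_bounded_ops M X nrm"
    and loc: "locally_as_bounded M X nrm V" and "0 < l"
  obtains b where "b \<in> L0_plus M" "\<And>s. s \<in> {0..l} \<Longrightarrow> b \<in> op_bounds M X nrm (V s)"
proof -
  let ?A = "(\<lambda>s. op_nrm M X nrm (V s)) ` {0..l}"
  obtain b where b: "b \<in> L0_plus M" "\<Squnion>\<^bsub>L0_bar M\<^esub> ?A = L0_ereal M b"
    using loc \<open>0 < l\<close> unfolding locally_as_bounded_def by blast
  have A: "?A \<subseteq> L0 M" using op_nrm_in_L0 by auto
  have "L0_le M (op_nrm M X nrm (V s)) (L0_ereal M b)" if "s \<in> {0..l}" for s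
    using least_L0_bar_sup[OF A] that op_nrm_in_L0 unfolding b(2)
    by (auto simp: least_def Upper_def L0_bar_def)
  then show ?thesis using V b(1) by (intro that[of b] op_boundsI_op_nrm) auto
qed

lemma as_bounded_ops_closed: "T \<in> as_bounded_ops M X nrm \<Longrightarrow> x \<in> carrier X \<Longrightarrow> T x \<in> carrier X"
  by (auto simp: as_bounded_ops_def linear_operator_def)

lemma as_bounded_ops_minus:
  assumes T: "T \<in> as_bounded_ops M X nrm" and xy: "x \<in> carrier X" "y \<in> carrier X"
  shows "T (x \<ominus>\<^bsub>X\<^esub> y) = T x \<ominus>\<^bsub>X\<^esub> T y"
proof -
  have "T ((x \<ominus>\<^bsub>X\<^esub> y) \<oplus>\<^bsub>X\<^esub> y) = T (x \<ominus>\<^bsub>X\<^esub> y) \<oplus>\<^bsub>X\<^esub> T y"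
    using T xy by (auto simp: as_bounded_ops_def linear_operator_def)
  moreover have "(x \<ominus>\<^bsub>X\<^esub> y) \<oplus>\<^bsub>X\<^esub> y = x"
    using xy by (simp add: a_minus_def M.a_assoc M.l_neg)
  moreover have "T x \<in> carrier X" "T y \<in> carrier X" "T (x \<ominus>\<^bsub>X\<^esub> y) \<in> carrier X"
    using as_bounded_ops_closed[OF T] xy by simp_all
  ultimately show ?thesis
    by (simp add: a_minus_def M.a_assoc M.r_neg)
qed

section \<open>Continuity of paths and increments of a \<open>C\<close>-semigroup\<close>

lemma limitin_translate_el_nbhd_at:
  assumes cont: "continuous_map (top_of_set {0..}) (el_topology M X nrm) f"
    and "(0::real) \<le> t" "0 < \<epsilon>" "\<delta> \<in> {0<..<1}"
  obtains d where "0 < d" "\<And>r. 0 \<le> r \<Longrightarrow> \<bar>r - t\<bar> < d \<Longrightarrow> f r \<ominus>\<^bsub>X\<^esub> f t \<in> el_nbhd M X nrm \<epsilon> \<delta>"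
proof -
  have "limitin (el_topology M X nrm) f (f t) (at t within {0..})"
    using cont \<open>0 \<le> t\<close> unfolding continuous_map_atin by (auto simp: atin_subtopology_within atin_within_euclidean)
  from limitin_el_nbhd[OF this assms(3,4)] obtain d where d: "0 < d"
    "\<And>r. 0 \<le> r \<Longrightarrow> r \<noteq> t \<Longrightarrow> \<bar>r - t\<bar> < d \<Longrightarrow> f r \<ominus>\<^bsub>X\<^esub> f t \<in> el_nbhd M X nrm \<epsilon> \<delta>"
    unfolding eventually_at by (auto simp: dist_real_def)
  have "f t \<in> carrier X"
    using cont \<open>0 \<le> t\<close> unfolding continuous_map_def topspace_el_topology[OF rn_module_axioms] by auto
  \<comment> \<open>The punctured limit says nothing at \<open>r = t\<close>; there the difference
    is zero and lies in the neighbourhood.\<close>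
  from minus_self_in_el_nbhd[OF this assms(3), of \<delta>] d assms(4) show ?thesis
    by (intro that[of d]) (metis greaterThanLessThan_iff)+
qed

text \<open>Induction on the number of grid steps. The semigroup law is available only after
  applying \<open>C\<close>; at \<open>C x\<close> it makes each increment the image of the same
  vector \<open>V h x \<ominus> C x\<close> under some \<open>V r\<close>.\<close>

lemma C_semigroup_grid_bound:
  assumes sg: "C_semigroup M X nrm C V"
    and b: "\<And>r. r \<in> {0..l} \<Longrightarrow> b \<in> op_bounds M X nrm (V r)"
    and x: "x \<in> carrier X" and s: "0 \<le> s" and h: "0 \<le> h"
    and kh: "s + real k * h \<le> l"
  shows "AE w in M. N (V (s + real k * h) (C x) \<ominus>\<^bsub>X\<^esub> V s (C x)) w
    \<le> real k * (L0_rep b w * N (V h x \<ominus>\<^bsub>X\<^esub> C x) w)"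
  using kh
proof (induction k)
  case 0
  have "V s (C x) \<in> carrier X"
    using sg s x as_bounded_ops_closed[of C x] as_bounded_ops_closed[of "V s" "C x"]
    by (simp add: C_semigroup_def)
  then show ?case using N_zero by (auto simp: a_minus_def M.r_neg elim: eventually_mono)
next
  case (Suc k)
  define r where "r = s + real k * h"
  have r: "0 \<le> r" using s h by (simp add: r_def)
  have rh: "s + real (Suc k) * h = r + h" by (simp add: r_def algebra_simps)
  have rl: "r \<in> {0..l}" using Suc.prems h r unfolding rh by simp
  have V: "V t \<in> as_bounded_ops M X nrm" if "0 \<le> t" for t
    using sg that by (simp add: C_semigroup_def)
  have C: "C \<in> as_bounded_ops M X nrm" using sg by (simp add: C_semigroup_def)
  have V_comm: "C (V (p + q) x) = V p (V q x)" if "0 \<le> p" "0 \<le> q" for p q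
    using sg that x by (simp add: C_semigroup_def)
  have V0: "V 0 x = C x" using sg x by (simp add: C_semigroup_def)
  have Cx: "C x \<in> carrier X" and Vh: "V h x \<in> carrier X"
    using as_bounded_ops_closed[OF C x] as_bounded_ops_closed[OF V[OF h] x] by auto
  have closed: "V t (C x) \<in> carrier X" if "0 \<le> t" for t
    by (rule as_bounded_ops_closed[OF V[OF that] Cx])
  \<comment> \<open>Second time 0 in the semigroup law: \<open>C\<close> commutes with
    \<open>V t\<close> at \<open>x\<close>.\<close>
  have V0C: "V t (C x) = C (V t x)" if "0 \<le> t" for t
    using V_comm[OF that order_refl] V0 by simp
  have step: "V (r + h) (C x) \<ominus>\<^bsub>X\<^esub> V r (C x) = V r (V h x \<ominus>\<^bsub>X\<^esub> C x)"
    using V0C[of "r + h"] V_comm[OF r h] r h by (simp add: as_bounded_ops_minus[OF V[OF r] Vh Cx])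
  have "AE w in M. N (V (r + h) (C x) \<ominus>\<^bsub>X\<^esub> V r (C x)) w \<le> L0_rep b w * N (V h x \<ominus>\<^bsub>X\<^esub> C x) w"
    unfolding step by (rule op_bounds_AE[OF b[OF rl]]) (use Cx Vh in simp)
  moreover have "AE w in M. N (V r (C x) \<ominus>\<^bsub>X\<^esub> V s (C x)) w \<le> real k * (L0_rep b w * N (V h x \<ominus>\<^bsub>X\<^esub> C x) w)"
    using Suc.IH rl unfolding r_def by simp
  moreover have "AE w in M. N (V (r + h) (C x) \<ominus>\<^bsub>X\<^esub> V s (C x)) w
      \<le> N (V (r + h) (C x) \<ominus>\<^bsub>X\<^esub> V r (C x)) w + N (V r (C x) \<ominus>\<^bsub>X\<^esub> V s (C x)) w"
    using r h s by (intro N_minus_triangle closed) auto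
  ultimately show ?case
    unfolding rh by eventually_elim (simp add: algebra_simps)
qed

text \<open>For fixed \<open>\<epsilon>\<close>, an event of probability as close to 1 as desired
  carries the estimate with an \<open>\<epsilon>\<close> error, so this estimate holds almost
  surely; then \<open>\<epsilon>\<close> tends to 0. The step length depends on
  \<open>\<epsilon>\<close> and on the required probability.\<close>

lemma C_semigroup_increment_bound:
  assumes sg: "C_semigroup M X nrm C V"
    and b: "b \<in> L0_plus M" "\<And>r. r \<in> {0..l} \<Longrightarrow> b \<in> op_bounds M X nrm (V r)"
    and x: "x \<in> carrier X"
    and y: "limitin (el_topology M X nrm) (diff_quot M X C V x) y (at_right 0)"
    and st: "0 \<le> s" "s \<le> t" "t \<le> l"
  shows "AE w in M. N (V t (C x) \<ominus>\<^bsub>X\<^esub> V s (C x)) w \<le> L0_rep b w * N y w * (t - s)"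
proof -
  have V: "V r \<in> as_bounded_ops M X nrm" if "0 \<le> r" for r
    using sg that by (simp add: C_semigroup_def)
  have C: "C \<in> as_bounded_ops M X nrm" using sg by (simp add: C_semigroup_def)
  have Cx: "C x \<in> carrier X" by (rule as_bounded_ops_closed[OF C x])
  have yc: "y \<in> carrier X"
    using limitin_topspace[OF y] by (simp add: topspace_el_topology[OF rn_module_axioms])
  define W where "W r = V r (C x)" for r
  have W: "W r \<in> carrier X" if "0 \<le> r" for r
    unfolding W_def by (rule as_bounded_ops_closed[OF V[OF that] Cx])
  have t0: "0 \<le> t" using st by simp
  have Wts: "W t \<ominus>\<^bsub>X\<^esub> W s \<in> carrier X" using W st by simp
  note [measurable] = N_measurable[OF Wts] N_measurable[OF yc] L0_plus_rep_measurable[OF b(1)]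
  have cont: "continuous_map (top_of_set {0..}) (el_topology M X nrm) W"
    using sg Cx by (simp add: C_semigroup_def W_def[abs_def])
  \<comment> \<open>The first \<open>\<epsilon>\<close> pays for the gap between \<open>t\<close>
    and the last grid point, the second for replacing the difference quotient by its limit
    \<open>y\<close>.\<close>
  let ?Q = "\<lambda>\<epsilon> w. N (W t \<ominus>\<^bsub>X\<^esub> W s) w \<le> \<epsilon> + L0_rep b w * (\<epsilon> + N y w) * (t - s)"
  have eps: "AE w in M. ?Q \<epsilon> w" if \<epsilon>: "0 < \<epsilon>" for \<epsilon>
  proof (rule AE_if_prob_ge)
    show "{w \<in> space M. ?Q \<epsilon> w} \<in> events" by measurable
    fix \<delta>' :: real assume "0 < \<delta>'"
    \<comment> \<open>Two events of probability above \<open>\<delta>\<close> meet with probability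
      above \<open>2 * \<delta> - 1\<close>, hence above \<open>1 - \<delta>'\<close>; the maximum
      with \<open>1/2\<close> keeps \<open>\<delta>\<close> positive for large
      \<open>\<delta>'\<close>.\<close>
    define \<delta> where "\<delta> = max (1/2) (1 - \<delta>' / 2)"
    have \<delta>: "\<delta> \<in> {0<..<1}" using \<open>0 < \<delta>'\<close> by (auto simp: \<delta>_def)
    obtain d where d: "0 < d" "\<And>r. 0 \<le> r \<Longrightarrow> \<bar>r - t\<bar> < d \<Longrightarrow> W r \<ominus>\<^bsub>X\<^esub> W t \<in> el_nbhd M X nrm \<epsilon> \<delta>"
      using limitin_translate_el_nbhd_at[OF cont t0 \<epsilon> \<delta>] by blast
    obtain e where e: "0 < e"
      "\<And>h. 0 < h \<Longrightarrow> h < e \<Longrightarrow> diff_quot M X C V x h \<ominus>\<^bsub>X\<^esub> y \<in> el_nbhd M X nrm \<epsilon> \<delta>"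
      using limitin_el_nbhd[OF y \<epsilon> \<delta>] by (auto simp: eventually_at_right[of 0 1])
    define h where "h = min d e / 2"
    have h: "0 < h" "h < d" "h < e" using d(1) e(1) by (auto simp: h_def)
    \<comment> \<open>The floor puts the last grid point \<open>r\<close> into
      \<open>(t - h, t]\<close>, and \<open>h < d\<close> brings it into the range where continuity
      at \<open>t\<close> applies.\<close>
    define k where "k = nat \<lfloor>(t - s) / h\<rfloor>"
    have "real k \<le> (t - s) / h" "(t - s) / h < real k + 1"
      using st h by (simp_all add: k_def)
    then have kh: "real k * h \<le> t - s" "t - s < real k * h + h"
      using h by (simp_all add: field_simps)
    define r where "r = s + real k * h"
    have r: "0 \<le> r" "\<bar>r - t\<bar> < d" using kh h st by (auto simp: r_def)
    define q where "q = diff_quot M X C V x h"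
    have Vh: "V h x \<ominus>\<^bsub>X\<^esub> C x \<in> carrier X"
      using as_bounded_ops_closed[OF V x, of h] h Cx by simp
    have q: "q \<in> carrier X"
      unfolding q_def diff_quot_def by (rule smult_closed[OF const_in_ring Vh])
    have rt: "W r \<ominus>\<^bsub>X\<^esub> W t \<in> carrier X" and qy: "q \<ominus>\<^bsub>X\<^esub> y \<in> carrier X"
      using W r t0 q yc by simp_all
    note [measurable] = N_measurable[OF rt] N_measurable[OF qy]
    have "AE w in M. N q w = norm (of_real (1 / h) :: 'k) * N (V h x \<ominus>\<^bsub>X\<^esub> C x) w"
      unfolding q_def diff_quot_def by (rule N_const_smult[OF Vh])
    then have Nq: "AE w in M. N (V h x \<ominus>\<^bsub>X\<^esub> C x) w = h * N q w"
      using h by (auto simp: norm_divide)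
    have grid: "AE w in M. N (W r \<ominus>\<^bsub>X\<^esub> W s) w \<le> real k * (L0_rep b w * N (V h x \<ominus>\<^bsub>X\<^esub> C x) w)"
      unfolding W_def r_def using b(2) st kh h by (intro C_semigroup_grid_bound[OF sg _ x]) auto
    \<comment> \<open>On the event where both errors are below \<open>\<epsilon>\<close>, the
      increment from \<open>W s\<close> to \<open>W t\<close> is split at \<open>W r\<close>, and
      \<open>N q\<close> is replaced by \<open>\<epsilon> + N y\<close>.\<close>
    have imp: "AE w in M. N (W r \<ominus>\<^bsub>X\<^esub> W t) w < \<epsilon> \<and> N (q \<ominus>\<^bsub>X\<^esub> y) w < \<epsilon> \<longrightarrow> ?Q \<epsilon> w"
      using Nq grid N_minus_commute[OF W[OF r(1)] W[OF t0]]
        N_minus_triangle[OF W[OF t0] W[OF r(1)] W[OF st(1)]]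
        N_triangle[OF qy yc] N_nonneg[OF q] L0_plus_rep_nonneg[OF b(1)]
    proof eventually_elim
      case (elim w)
      have q_eq: "(q \<ominus>\<^bsub>X\<^esub> y) \<oplus>\<^bsub>X\<^esub> y = q"
        using q yc by (simp add: a_minus_def M.a_assoc M.l_neg)
      show ?case
      proof
        assume small: "N (W r \<ominus>\<^bsub>X\<^esub> W t) w < \<epsilon> \<and> N (q \<ominus>\<^bsub>X\<^esub> y) w < \<epsilon>"
        \<comment> \<open>The factor \<open>h\<close> from the difference quotient turns the number
          of steps \<open>k\<close> into the length \<open>k * h\<close>, which is at most
          \<open>t - s\<close> however small \<open>h\<close> is.\<close>
        have "real k * (L0_rep b w * (h * N q w)) = (real k * h) * (L0_rep b w * N q w)" by simp
        also have "\<dots> \<le> (t - s) * (L0_rep b w * (\<epsilon> + N y w))"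
          using elim small st kh unfolding q_eq by (intro mult_mono mult_nonneg_nonneg) auto
        finally show "?Q \<epsilon> w"
          using elim small by (simp add: mult.commute)
      qed
    qed
    have "1 - \<delta>' \<le> \<delta> + \<delta> - 1" by (auto simp: \<delta>_def max_def)
    also have "\<dots> \<le> prob {w \<in> space M. N (W r \<ominus>\<^bsub>X\<^esub> W t) w < \<epsilon>}
        + prob {w \<in> space M. N (q \<ominus>\<^bsub>X\<^esub> y) w < \<epsilon>} - 1"
      using d(2)[OF r] e(2)[OF h(1,3)] by (auto simp: el_nbhd_def q_def)
    also have "\<dots> \<le> prob {w \<in> space M. N (W r \<ominus>\<^bsub>X\<^esub> W t) w < \<epsilon> \<and> N (q \<ominus>\<^bsub>X\<^esub> y) w < \<epsilon>}"
      by (rule prob_conj_ge) measurable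
    also have "\<dots> \<le> prob {w \<in> space M. ?Q \<epsilon> w}"
      by (rule finite_measure_mono_AE) (use imp in \<open>auto elim: eventually_mono\<close>)
    finally show "1 - \<delta>' \<le> prob {w \<in> space M. ?Q \<epsilon> w}" .
  qed
  \<comment> \<open>Restricting to the sequence \<open>1 / (n + 1)\<close> leaves countably many
    null sets, so the limit can be taken pointwise.\<close>
  have "AE w in M. \<forall>n. ?Q (inverse (real (Suc n))) w"
    unfolding AE_all_countable by (intro allI eps) simp
  then show ?thesis
  proof eventually_elim
    case (elim w)
    have "(\<lambda>n. inverse (real (Suc n)) + L0_rep b w * (inverse (real (Suc n)) + N y w) * (t - s))
        \<longlonglongrightarrow> 0 + L0_rep b w * (0 + N y w) * (t - s)"
      by (intro tendsto_intros LIMSEQ_inverse_real_of_nat)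
    then have "N (W t \<ominus>\<^bsub>X\<^esub> W s) w \<le> 0 + L0_rep b w * (0 + N y w) * (t - s)"
      by (rule LIMSEQ_le_const) (use elim in blast)
    then show ?case by (simp add: W_def)
  qed
qed

end

theorem theorem4p3:
  fixes M :: "'w measure"
    and X :: "(('w \<Rightarrow> 'k::{real_normed_field, second_countable_topology}) set, 'x) module"
    and nrm :: "'x \<Rightarrow> ('w \<Rightarrow> real) set"
    and C A :: "'x \<Rightarrow> 'x"
    and V :: "real \<Rightarrow> 'x \<Rightarrow> 'x"
    and D :: "'x set"
    and z :: 'x
  assumes "rn_module M X nrm"
    and "el_complete M X nrm"
    and "C \<in> as_bounded_ops M X nrm" and "inj_on C (carrier X)"
    and "C_semigroup M X nrm C V"
    and "locally_as_bounded M X nrm V"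
    and "is_generator M X nrm C V A D"
    and "z \<in> C ` D"
  shows "locally_L0_Lipschitz M X nrm (\<lambda>s. C (V s z))"
proof -
  interpret rn_module M X nrm by fact
  note C = \<open>C \<in> as_bounded_ops M X nrm\<close>
  note sg = \<open>C_semigroup M X nrm C V\<close>
  have V: "V r \<in> as_bounded_ops M X nrm" if "0 \<le> r" for r
    using sg that by (simp add: C_semigroup_def)
  \<comment> \<open>\<open>y\<close> is the limit of the difference quotients itself, before
    \<open>C\<close> is inverted; its norm enters the Lipschitz factor.\<close>
  obtain x y where x: "x \<in> carrier X" and z: "z = C x"
    and y: "limitin (el_topology M X nrm) (diff_quot M X C V x) y (at_right 0)"
    using assms(7,8) by (auto simp: is_generator_def gen_dom_def)
  have yc: "y \<in> carrier X"
    using limitin_topspace[OF y] by (simp add: topspace_el_topology[OF rn_module_axioms])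
  have zc: "z \<in> carrier X" unfolding z by (rule as_bounded_ops_closed[OF C x])
  have Vz: "V r z \<in> carrier X" if "0 \<le> r" for r
    by (rule as_bounded_ops_closed[OF V[OF that] zc])
  obtain c where c: "c \<in> op_bounds M X nrm C" using C by (auto simp: as_bounded_ops_def)
  then have c_plus: "c \<in> L0_plus M" by (simp add: op_bounds_def)
  have "\<exists>\<xi>\<in>L0_plus M. \<forall>s\<in>{0..l}. \<forall>t\<in>{0..l}.
      L0_le M (nrm (C (V s z) \<ominus>\<^bsub>X\<^esub> C (V t z))) (\<xi> \<otimes>\<^bsub>L0_ring M\<^esub> L0_const M \<bar>s - t\<bar>)"
    if "0 < l" for l
  proof -
    obtain b where b: "b \<in> L0_plus M" "\<And>r. r \<in> {0..l} \<Longrightarrow> b \<in> op_bounds M X nrm (V r)"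
      using locally_as_bounded_op_bounds[OF V \<open>locally_as_bounded M X nrm V\<close> \<open>0 < l\<close>] by blast
    note [measurable] = N_measurable[OF yc] L0_plus_rep_measurable[OF b(1)] L0_plus_rep_measurable[OF c_plus]
    \<comment> \<open>Product of a bound of \<open>C\<close>, the common bound of the operators on
      \<open>[0, l]\<close> and the norm of the limit; it depends on \<open>l\<close> only through
      \<open>b\<close>.\<close>
    define f where "f w = L0_rep c w * (L0_rep b w * N y w)" for w
    have f: "f \<in> borel_measurable M" unfolding f_def by measurable
    have f_plus: "L0_class M f \<in> L0_plus M"
    proof (rule L0_class_plusI[OF f])
      show "AE w in M. 0 \<le> f w"
        using L0_plus_rep_nonneg[OF b(1)] L0_plus_rep_nonneg[OF c_plus] N_nonneg[OF yc]
        by eventually_elim (simp add: f_def)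
    qed
    have le: "AE w in M. N (C (V t z) \<ominus>\<^bsub>X\<^esub> C (V s z)) w \<le> f w * (t - s)"
      if st: "0 \<le> s" "s \<le> t" "t \<le> l" for s t
    proof -
      have t0: "0 \<le> t" using st by simp
      have "V t z \<ominus>\<^bsub>X\<^esub> V s z \<in> carrier X" using Vz st by simp
      from op_bounds_AE[OF c this]
      have "AE w in M. N (C (V t z) \<ominus>\<^bsub>X\<^esub> C (V s z)) w \<le> L0_rep c w * N (V t z \<ominus>\<^bsub>X\<^esub> V s z) w"
        by (simp add: as_bounded_ops_minus[OF C Vz[OF t0] Vz[OF st(1)]])
      moreover have "AE w in M. N (V t z \<ominus>\<^bsub>X\<^esub> V s z) w \<le> L0_rep b w * N y w * (t - s)"
        unfolding z using b st by (intro C_semigroup_increment_bound[OF sg _ _ x y]) auto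
      ultimately show ?thesis
        using L0_plus_rep_nonneg[OF c_plus]
      proof eventually_elim
        case (elim w)
        have "L0_rep c w * N (V t z \<ominus>\<^bsub>X\<^esub> V s z) w \<le> L0_rep c w * (L0_rep b w * N y w * (t - s))"
          using elim by (intro mult_left_mono) auto
        with elim show ?case by (simp add: f_def mult.assoc)
      qed
    qed
    have "L0_le M (nrm (C (V s z) \<ominus>\<^bsub>X\<^esub> C (V t z))) (L0_class M f \<otimes>\<^bsub>L0_ring M\<^esub> L0_const M \<bar>s - t\<bar>)"
      if st: "s \<in> {0..l}" "t \<in> {0..l}" for s t
    proof -
      \<comment> \<open>The estimate \<open>le\<close> covers ordered times; the opposite order is
        reduced to it by symmetry of the norm of a difference.\<close>
      have "AE w in M. N (C (V s z) \<ominus>\<^bsub>X\<^esub> C (V t z)) w \<le> f w * \<bar>s - t\<bar>"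
      proof (cases "t \<le> s")
        case True
        then show ?thesis using le[of t s] st by simp
      next
        case False
        have "C (V s z) \<in> carrier X" "C (V t z) \<in> carrier X"
          using st Vz as_bounded_ops_closed[OF C] by auto
        from N_minus_commute[OF this] le[of s t] False st show ?thesis
          by (auto elim: eventually_elim2)
      qed
      moreover have "AE w in M. L0_rep (L0_class M f \<otimes>\<^bsub>L0_ring M\<^esub> L0_const M \<bar>s - t\<bar>) w
          = L0_rep (L0_class M f) w * L0_rep (L0_const M \<bar>s - t\<bar>) w"
        by (intro L0_rep_mult L0_plus_rep_measurable[OF f_plus] L0_rep_measurable[OF L0_const_in_L0])
      ultimately show ?thesis
        unfolding L0_le_def using L0_rep_class[OF f] L0_rep_const[of M "\<bar>s - t\<bar>"]
        by eventually_elim simp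
    qed
    then show ?thesis using f_plus by blast
  qed
  then show ?thesis
    unfolding locally_L0_Lipschitz_def using Vz as_bounded_ops_closed[OF C] by auto
qed

end
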